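(* Suppose a compact connected $C^{1,1}$ curve $L$ in $\mathbb{R}^3$ is nicely balanced by kink measure alone, with kink tension function $\phi$, and suppose that at some point $p\in L$ we have $\phi^2\tau\ne0$, where $\tau$ is the torsion. Then $\phi^2\tau=c$ is constant along all of $L$, and $\phi>0$ on $L$ satisfies $$\phi''=1-\phi+\frac{c^2}{\phi^3}.$$ The kink tension function $\phi$ on such an $L$ is uniquely determined.
   Context: Let $L$ be a compact connected $C^{1,1}$ curve (arc or closed, not necessarily embedded) with arclength derivative $'$, unit tangent $T$, curvature vector $\kappa=T'$ (defined a.e.), satisfying the curvature bound that $T$ is 1-Lipschitz in arclength. Nicely balanced by kink measure alone (fixed endpoints with fixed tangents): there is a nonnegative function $\phi\in W^{1,BV}(L)$ (distributional derivative of bounded variation), called a kink tension function, such that on the open set $U=\{\phi>0\}$ the curve $L$ is $C^2$ with $|\kappa|\equiv1$ and, with $N=\kappa/|\kappa|$ on $U$ and $\phi N:=0$ off $U$, the virtual tangent $V=(1-2\phi)T-(\phi N)'$ is a constant vector along $L$. (No conditions are imposed at endpoints.) On $U$, $N$ is then locally in $W^{1,BV}$, so with $B=T\times N$ the torsion $\tau=\langle N',B\rangle$ is defined on $U$; the hypothesis $\phi^2\tau\neq0$ at $p$ means $p\in U$ and $\tau(p)\ne0$. *)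

theory Defs
  imports "HOL-Analysis.Analysis"
begin

section \<open>Compact connected curves parametrized by arclength\<close>

text \<open>
  A compact connected curve \<open>L\<close> of length \<open>l > 0\<close> is either an arc or closed. It is
  given by an arclength parametrization \<open>\<gamma>\<close>, which need not be injective. The parameter
  domain of an arc is \<open>{0..l}\<close>; that of a closed curve is the universal cover of the circle
  of length \<open>l\<close>, so functions on a closed curve are the \<open>l\<close>-periodic functions on the line.
  All derivatives are taken within the parameter domain, hence are one-sided at the endpoints
  of an arc.
\<close>

datatype curve_kind = Arc | Closed

definition params :: "curve_kind \<Rightarrow> real \<Rightarrow> real set" where
  "params k l = (case k of Arc \<Rightarrow> {0..l} | Closed \<Rightarrow> UNIV)"

definition function_on_curve :: "curve_kind \<Rightarrow> real \<Rightarrow> (real \<Rightarrow> 'a) \<Rightarrow> bool" where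
  "function_on_curve k l f \<longleftrightarrow> (case k of Arc \<Rightarrow> True | Closed \<Rightarrow> (\<forall>s. f (s + l) = f s))"

definition tangent :: "curve_kind \<Rightarrow> real \<Rightarrow> (real \<Rightarrow> real ^ 3) \<Rightarrow> real \<Rightarrow> real ^ 3" where
  "tangent k l \<gamma> s = vector_derivative \<gamma> (at s within params k l)"

definition C11_curve :: "curve_kind \<Rightarrow> real \<Rightarrow> (real \<Rightarrow> real ^ 3) \<Rightarrow> bool" where
  "C11_curve k l \<gamma> \<longleftrightarrow>
     0 < l \<and> function_on_curve k l \<gamma> \<and>
     (\<forall>s\<in>params k l. \<gamma> differentiable (at s within params k l) \<and> norm (tangent k l \<gamma> s) = 1) \<and>
     1-lipschitz_on (params k l) (tangent k l \<gamma>)"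

definition curvature_vector :: "curve_kind \<Rightarrow> real \<Rightarrow> (real \<Rightarrow> real ^ 3) \<Rightarrow> real \<Rightarrow> real ^ 3" where
  "curvature_vector k l \<gamma> s = vector_derivative (tangent k l \<gamma>) (at s within params k l)"

definition normal :: "curve_kind \<Rightarrow> real \<Rightarrow> (real \<Rightarrow> real ^ 3) \<Rightarrow> real \<Rightarrow> real ^ 3" where
  "normal k l \<gamma> s = curvature_vector k l \<gamma> s /\<^sub>R norm (curvature_vector k l \<gamma> s)"

definition binormal :: "curve_kind \<Rightarrow> real \<Rightarrow> (real \<Rightarrow> real ^ 3) \<Rightarrow> real \<Rightarrow> real ^ 3" where
  "binormal k l \<gamma> s = cross3 (tangent k l \<gamma> s) (normal k l \<gamma> s)"

text \<open>
  The torsion is only meaningful where the tangent and the normal are differentiable. For a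
  curve with kink tension function \<open>\<phi>\<close> this is the case on all of \<open>{\<phi> > 0}\<close>: there
  \<open>\<phi> N\<close> is continuous with continuous derivative \<open>(1 - 2 \<phi>) T - V\<close>, hence so are its norm
  \<open>\<phi>\<close> and the quotient \<open>N\<close>.
\<close>

definition torsion :: "curve_kind \<Rightarrow> real \<Rightarrow> (real \<Rightarrow> real ^ 3) \<Rightarrow> real \<Rightarrow> real" where
  "torsion k l \<gamma> s = vector_derivative (normal k l \<gamma>) (at s within params k l) \<bullet> binormal k l \<gamma> s"


section \<open>Distributional derivatives along a curve\<close>

definition smooth_fun :: "(real \<Rightarrow> real) \<Rightarrow> bool" where
  "smooth_fun \<psi> \<longleftrightarrow> (\<forall>n s. (deriv ^^ n) \<psi> differentiable (at s))"

text \<open>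
  On an arc, test functions have compact support in the open interval \<open>{0<..<l}\<close>, so a
  distributional derivative sees nothing at the endpoints. A closed curve has no endpoints.
\<close>

definition test_fun :: "curve_kind \<Rightarrow> real \<Rightarrow> (real \<Rightarrow> real) \<Rightarrow> bool" where
  "test_fun k l \<psi> \<longleftrightarrow> smooth_fun \<psi> \<and> function_on_curve k l \<psi> \<and>
     (k = Arc \<longrightarrow> (\<exists>a b. 0 < a \<and> b < l \<and> (\<forall>s. s \<notin> {a..b} \<longrightarrow> \<psi> s = 0)))"

definition has_weak_derivative ::
    "curve_kind \<Rightarrow> real \<Rightarrow> (real \<Rightarrow> 'a::euclidean_space) \<Rightarrow> (real \<Rightarrow> 'a) \<Rightarrow> bool" where
  "has_weak_derivative k l f g \<longleftrightarrow>
     f absolutely_integrable_on {0..l} \<and> g absolutely_integrable_on {0..l} \<and>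
     (\<forall>\<psi>. test_fun k l \<psi> \<longrightarrow>
        integral {0..l} (\<lambda>s. deriv \<psi> s *\<^sub>R f s) = - integral {0..l} (\<lambda>s. \<psi> s *\<^sub>R g s))"

definition bounded_variation_on :: "real \<Rightarrow> real \<Rightarrow> (real \<Rightarrow> real) \<Rightarrow> bool" where
  "bounded_variation_on a b g \<longleftrightarrow>
     (\<exists>M. \<forall>n (t :: nat \<Rightarrow> real).
        (\<forall>i\<le>n. t i \<in> {a..b}) \<and> (\<forall>i<n. t i \<le> t (Suc i)) \<longrightarrow>
        (\<Sum>i<n. \<bar>g (t (Suc i)) - g (t i)\<bar>) \<le> M)"

text \<open>
  Elements of \<open>W\<^sup>1\<^sup>,\<^sup>B\<^sup>V\<close> are identified with their continuous representatives; \<open>g\<close> is a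
  representative of the derivative with finite pointwise variation over one period.
\<close>

definition W1BV :: "curve_kind \<Rightarrow> real \<Rightarrow> (real \<Rightarrow> real) \<Rightarrow> bool" where
  "W1BV k l f \<longleftrightarrow> function_on_curve k l f \<and> continuous_on (params k l) f \<and>
     (\<exists>g. bounded_variation_on 0 l g \<and> has_weak_derivative k l f g)"


section \<open>Balance by kink measure alone\<close>

definition kink_normal ::
    "curve_kind \<Rightarrow> real \<Rightarrow> (real \<Rightarrow> real ^ 3) \<Rightarrow> (real \<Rightarrow> real) \<Rightarrow> real \<Rightarrow> real ^ 3" where
  "kink_normal k l \<gamma> \<phi> s = (if \<phi> s > 0 then \<phi> s *\<^sub>R normal k l \<gamma> s else 0)"

text \<open>
  The last conjunct says that the virtual tangent \<open>(1 - 2 \<phi>) T - (\<phi> N)'\<close>, formed with the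
  distributional derivative of \<open>\<phi> N\<close>, is a constant vector \<open>V\<close>.
\<close>

definition kink_tension_function ::
    "curve_kind \<Rightarrow> real \<Rightarrow> (real \<Rightarrow> real ^ 3) \<Rightarrow> (real \<Rightarrow> real) \<Rightarrow> bool" where
  "kink_tension_function k l \<gamma> \<phi> \<longleftrightarrow>
     W1BV k l \<phi> \<and> (\<forall>s\<in>params k l. 0 \<le> \<phi> s) \<and>
     (let U = {s \<in> params k l. 0 < \<phi> s} in
        (\<forall>s\<in>U. tangent k l \<gamma> differentiable (at s within params k l)) \<and>
        continuous_on U (curvature_vector k l \<gamma>) \<and>
        (\<forall>s\<in>U. norm (curvature_vector k l \<gamma> s) = 1)) \<and>
     (\<exists>V. has_weak_derivative k l (kink_normal k l \<gamma> \<phi>)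
            (\<lambda>s. (1 - 2 * \<phi> s) *\<^sub>R tangent k l \<gamma> s - V))"

end

theory Submission
  imports Defs
begin

text \<open>
  Write \<open>W = \<phi> N\<close> for the kink normal. Since \<open>W\<close> and its weak derivative \<open>(1 - 2 \<phi>) T - V\<close> are
  continuous, \<open>W\<close> is continuously differentiable. On \<open>{\<phi> > 0}\<close> this makes \<open>\<phi> = \<bar>W\<bar>\<close> and \<open>N = W / \<phi>\<close>
  differentiable, with \<open>\<phi>' = - \<langle>V, N\<rangle>\<close>, and differentiating \<open>\<langle>T, W\<rangle> = 0\<close> gives \<open>\<langle>V, T\<rangle> = 1 - \<phi>\<close>.
  The function \<open>h = - \<langle>V, T \<times> W\<rangle>\<close> is continuous along the whole curve, equals \<open>\<phi>\<^sup>2 \<tau>\<close> where \<open>\<phi> > 0\<close>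
  and has derivative \<open>\<langle>V, T \<times> V\<rangle> = 0\<close> there, and vanishes where \<open>\<phi> = 0\<close>. Hence \<open>{h = c}\<close> is open and
  closed for every \<open>c \<noteq> 0\<close>. Differentiating \<open>- \<langle>V, N\<rangle>\<close> once more yields \<open>\<phi>'' = 1 - \<phi> + \<phi> \<tau>\<^sup>2\<close>.
  As the torsion depends only on the curve, a second tension function \<open>\<psi>\<close> is a constant multiple
  of \<open>\<phi>\<close>; the inhomogeneous term of the differential equation forces the factor to be \<open>1\<close>.
\<close>

section \<open>Smooth bumps along a curve\<close>

text \<open>The derivative is an explicit witness instead of an iterated \<open>deriv\<close>, so
  that sums, products and compositions are handled by plain induction on the order.\<close>

primrec n_times_diff :: "nat \<Rightarrow> (real \<Rightarrow> real) \<Rightarrow> bool" where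
  "n_times_diff 0 f \<longleftrightarrow> True"
| "n_times_diff (Suc n) f \<longleftrightarrow>
     (\<exists>f'. (\<forall>x. (f has_real_derivative f' x) (at x)) \<and> n_times_diff n f')"

lemma n_times_diff_Suc_imp: "n_times_diff (Suc n) f \<Longrightarrow> n_times_diff n f"
  by (induction n arbitrary: f) (simp, metis n_times_diff.simps(2))

lemma smooth_fun_if_n_times_diff:
  assumes "\<And>n. n_times_diff n f"
  shows "smooth_fun f"
proof -
  \<comment> \<open>One extra order is assumed because the \<open>n\<close>-th derivative must
    itself be differentiable.\<close>
  have "(deriv ^^ n) g differentiable (at s)" if "n_times_diff (Suc n) g" for n g s
    using that
  proof (induction n arbitrary: g)
    case 0
    then show ?case by (auto simp: real_differentiable_def)
  next
    case (Suc n)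
    then obtain g' where g': "\<And>x. (g has_real_derivative g' x) (at x)" "n_times_diff (Suc n) g'"
      unfolding n_times_diff.simps(2)[of "Suc n"] by blast
    then have "deriv g = g'"
      by (intro ext DERIV_imp_deriv) blast
    then show ?case
      using Suc.IH[OF g'(2)] by (simp only: funpow_Suc_right o_apply)
  qed
  then show ?thesis
    unfolding smooth_fun_def using assms by blast
qed

section \<open>Closure properties of repeated differentiability\<close>

lemma n_times_diff_const: "n_times_diff n (\<lambda>x. c)"
proof (induction n arbitrary: c)
  case (Suc n)
  show ?case by (auto intro!: exI[of _ "\<lambda>x. 0"] Suc)
qed simp

lemma n_times_diff_ident: "n_times_diff n (\<lambda>x. x)"
  by (cases n) (auto intro!: exI[of _ "\<lambda>x. 1"] n_times_diff_const)

lemma n_times_diff_add: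
  "n_times_diff n f \<Longrightarrow> n_times_diff n g \<Longrightarrow> n_times_diff n (\<lambda>x. f x + g x)"
proof (induction n arbitrary: f g)
  case (Suc n)
  then obtain f' g' where "\<And>x. (f has_real_derivative f' x) (at x)" "n_times_diff n f'"
    "\<And>x. (g has_real_derivative g' x) (at x)" "n_times_diff n g'"
    by auto
  then show ?case
    by (auto intro!: exI[of _ "\<lambda>x. f' x + g' x"] Suc.IH derivative_intros)
qed simp

lemma n_times_diff_mult:
  "n_times_diff n f \<Longrightarrow> n_times_diff n g \<Longrightarrow> n_times_diff n (\<lambda>x. f x * g x)"
proof (induction n arbitrary: f g)
  case (Suc n)
  then obtain f' g' where *: "\<And>x. (f has_real_derivative f' x) (at x)" "n_times_diff n f'"
    "\<And>x. (g has_real_derivative g' x) (at x)" "n_times_diff n g'"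
    by auto
  have "n_times_diff n f" "n_times_diff n g"
    using Suc.prems n_times_diff_Suc_imp by blast+
  with * show ?case
    by (auto intro!: exI[of _ "\<lambda>x. f' x * g x + g' x * f x"] Suc.IH n_times_diff_add DERIV_mult)
qed simp

lemma n_times_diff_cmult: "n_times_diff n f \<Longrightarrow> n_times_diff n (\<lambda>x. c * f x)"
  by (intro n_times_diff_mult n_times_diff_const)

lemma n_times_diff_diff:
  "n_times_diff n f \<Longrightarrow> n_times_diff n g \<Longrightarrow> n_times_diff n (\<lambda>x. f x - g x)"
  using n_times_diff_add[OF _ n_times_diff_cmult[of n g "-1"], of f] by simp

lemma n_times_diff_compose:
  "n_times_diff n f \<Longrightarrow> n_times_diff n g \<Longrightarrow> n_times_diff n (\<lambda>x. f (g x))"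
proof (induction n arbitrary: f g)
  case (Suc n)
  then obtain f' g' where *: "\<And>x. (f has_real_derivative f' x) (at x)" "n_times_diff n f'"
    "\<And>x. (g has_real_derivative g' x) (at x)" "n_times_diff n g'"
    by auto
  have "n_times_diff n g"
    using Suc.prems n_times_diff_Suc_imp by blast
  then have "n_times_diff n (\<lambda>x. f' (g x) * g' x)"
    using * by (intro n_times_diff_mult Suc.IH[of f' g])
  moreover have "((\<lambda>x. f (g x)) has_real_derivative f' (g x) * g' x) (at x)" for x
    by (rule DERIV_chain2) (rule *)+
  ultimately show ?case
    by (auto intro!: exI[of _ "\<lambda>x. f' (g x) * g' x"])
qed simp

lemma n_times_diff_sin_cos: "n_times_diff n sin \<and> n_times_diff n cos"
proof (induction n)
  case (Suc n)
  then have "n_times_diff n (\<lambda>x. - sin x)"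
    using n_times_diff_cmult[of n sin "-1"] by simp
  then have "n_times_diff (Suc n) cos"
    by (auto intro!: exI[of _ "\<lambda>x. - sin x"] derivative_eq_intros)
  moreover have "n_times_diff (Suc n) sin"
    using Suc by (auto intro!: exI[of _ cos] derivative_eq_intros)
  ultimately show ?case by blast
qed simp

text \<open>The case \<open>j = 0\<close> is the classical smooth function that is flat at 0. The
  powers of \<open>inverse x\<close> are included because differentiation then stays within linear
  combinations of the family.\<close>

definition flat_exp :: "nat \<Rightarrow> real \<Rightarrow> real" where
  "flat_exp j x = (if 0 < x then inverse x ^ j * exp (- inverse x) else 0)"

lemma flat_exp_tendsto_0: "(flat_exp j \<longlongrightarrow> 0) (at 0)"
proof -
  have "((\<lambda>x. inverse x ^ j / exp (inverse x)) \<longlongrightarrow> (0::real)) (at_right 0)"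
    by (rule filterlim_compose[OF tendsto_power_div_exp_0 filterlim_inverse_at_top_right])
  then have "(flat_exp j \<longlongrightarrow> 0) (at_right 0)"
    by (rule Lim_transform_eventually)
      (auto simp: flat_exp_def exp_minus divide_inverse eventually_at_filter)
  moreover have "(flat_exp j \<longlongrightarrow> 0) (at_left 0)"
    by (rule Lim_transform_eventually[OF tendsto_const])
      (auto simp: flat_exp_def eventually_at_filter)
  ultimately show ?thesis
    by (simp add: filterlim_split_at)
qed

lemma flat_exp_deriv:
  "(flat_exp j has_real_derivative flat_exp (j + 2) x - real j * flat_exp (j + 1) x) (at x)"
proof (cases x "0 :: real" rule: linorder_cases)
  case less
  then have "\<forall>\<^sub>F y in nhds x. flat_exp j y = 0"
    by (auto simp: flat_exp_def eventually_nhds intro!: exI[of _ "{..<0}"])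
  then have "(flat_exp j has_real_derivative 0) (at x) \<longleftrightarrow> ((\<lambda>_. 0) has_real_derivative 0) (at x)"
    by (intro DERIV_cong_ev) auto
  with less show ?thesis
    by (simp add: flat_exp_def)
next
  case equal
  \<comment> \<open>The difference quotient at 0 is again a member of the family, with exponent
    \<open>Suc j\<close>.\<close>
  have "((\<lambda>y. (flat_exp j y - flat_exp j 0) / (y - 0)) \<longlongrightarrow> 0) (at 0)"
    by (rule Lim_transform_eventually[OF flat_exp_tendsto_0[of "Suc j"]])
      (auto simp: flat_exp_def eventually_at_filter divide_inverse)
  with equal show ?thesis
    by (simp add: has_field_derivative_iff flat_exp_def)
next
  case greater
  have "((\<lambda>y. inverse y ^ j) has_real_derivative - real j * inverse x ^ (j + 1)) (at x)"
    using greater DERIV_power[OF DERIV_inverse[of x], of j]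
    by (cases j) (simp_all add: algebra_simps)
  moreover have "((\<lambda>y. exp (- inverse y)) has_real_derivative
      exp (- inverse x) * (inverse x * inverse x)) (at x)"
    using greater by (auto intro!: derivative_eq_intros)
  ultimately have "((\<lambda>y. inverse y ^ j * exp (- inverse y)) has_real_derivative
      flat_exp (j + 2) x - real j * flat_exp (j + 1) x) (at x)"
    using greater by (auto dest: DERIV_mult simp: flat_exp_def algebra_simps)
  moreover have "\<forall>\<^sub>F y in nhds x. flat_exp j y = inverse y ^ j * exp (- inverse y)"
    using greater by (auto simp: flat_exp_def eventually_nhds intro!: exI[of _ "{0<..}"])
  ultimately show ?thesis
    by (subst DERIV_cong_ev[OF refl _ refl])
qed

lemma n_times_diff_flat_exp: "n_times_diff n (flat_exp j)"
proof (induction n arbitrary: j)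
  case (Suc n)
  then show ?case
    by (auto intro!: exI flat_exp_deriv n_times_diff_diff n_times_diff_cmult)
qed simp

lemma flat_exp_nonneg: "0 \<le> flat_exp j x"
  by (simp add: flat_exp_def)

lemma flat_exp_pos_iff: "0 < flat_exp j x \<longleftrightarrow> 0 < x"
  by (simp add: flat_exp_def)

text \<open>A cutoff of a distance-like function is composed with \<open>flat_exp 0\<close>. On an
  arc the bump vanishes on the whole line away from \<open>x\<close>; on a closed curve it is
  periodic, so its vanishing is controlled only within one period.\<close>

lemma bump_on_curve:
  assumes "0 < d" "d \<le> x" "x + d \<le> l"
  obtains \<eta> where "\<And>n. n_times_diff n \<eta>" "\<And>s. 0 \<le> \<eta> s" "function_on_curve k l \<eta>" "0 < \<eta> x"
    "\<And>s. s \<in> {0..l} \<Longrightarrow> d \<le> \<bar>s - x\<bar> \<Longrightarrow> \<eta> s = 0"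
    "\<And>s. k = Arc \<Longrightarrow> d \<le> \<bar>s - x\<bar> \<Longrightarrow> \<eta> s = 0"
proof (cases k)
  case Arc
  define \<eta> where "\<eta> s = flat_exp 0 (d * d - (s - x) * (s - x))" for s
  have van: "\<eta> s = 0" if "d \<le> \<bar>s - x\<bar>" for s
  proof -
    have "d * d \<le> \<bar>s - x\<bar> * \<bar>s - x\<bar>"
      using that assms by (intro mult_mono) auto
    then show ?thesis by (auto simp: \<eta>_def flat_exp_def)
  qed
  show ?thesis
  proof
    show "n_times_diff n \<eta>" for n
      unfolding \<eta>_def
      by (intro n_times_diff_compose[OF n_times_diff_flat_exp] n_times_diff_diff n_times_diff_mult
          n_times_diff_const n_times_diff_ident)
    show "function_on_curve k l \<eta>" by (simp add: function_on_curve_def Arc)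
    show "0 < \<eta> x" using assms by (simp add: \<eta>_def flat_exp_pos_iff)
  qed (use van in \<open>auto simp: \<eta>_def flat_exp_nonneg\<close>)
next
  case Closed
  define w where "w = 2 * pi / l"
  have w: "0 < w" "w * l = 2 * pi" using assms by (auto simp: w_def)
  \<comment> \<open>The cosine is a smooth periodic substitute for the distance: as
    \<open>w * d \<le> pi\<close>, the argument is positive exactly when \<open>s\<close> is within
    \<open>d\<close> of \<open>x\<close> modulo \<open>l\<close>.\<close>
  define \<eta> where "\<eta> s = flat_exp 0 (cos (w * (s - x)) - cos (w * d))" for s
  have wd: "0 < w * d" "w * d \<le> pi"
    using mult_left_mono[of "2 * d" l w] assms w by auto
  have van: "\<eta> s = 0" if "d \<le> \<bar>s - x\<bar>" "s \<in> {0..l}" for s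
  proof -
    define t where "t = w * \<bar>s - x\<bar>"
    have 1: "w * d \<le> t"
      using that w by (simp add: t_def)
    have "\<bar>s - x\<bar> \<le> l - d"
      using that assms by auto
    then have "t \<le> w * (l - d)"
      using w by (simp add: t_def)
    then have 2: "w * d \<le> 2 * pi - t"
      using w by (simp add: algebra_simps)
    have "cos t \<le> cos (w * d)"
    proof (cases "t \<le> pi")
      case True
      with 1 wd show ?thesis by (intro cos_monotone_0_pi_le) auto
    next
      \<comment> \<open>Beyond \<open>pi\<close> the angle is reflected to
        \<open>2 * pi - t\<close>, where the cosine is monotone again.\<close>
      case False
      then have "cos (2 * pi - t) \<le> cos (w * d)"
        using 2 wd by (intro cos_monotone_0_pi_le) auto
      then show ?thesis by (simp add: cos_diff)
    qed
    moreover have "cos (w * (s - x)) = cos t"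
      using w by (simp add: t_def abs_if algebra_simps cos_diff)
    ultimately show ?thesis by (auto simp: \<eta>_def flat_exp_def)
  qed
  show ?thesis
  proof
    have "n_times_diff n (\<lambda>s. cos (w * (s - x)))" for n
      by (rule n_times_diff_compose[where f = cos])
        (simp_all add: n_times_diff_sin_cos n_times_diff_cmult n_times_diff_diff n_times_diff_const
          n_times_diff_ident)
    then show "n_times_diff n \<eta>" for n
      unfolding \<eta>_def
      by (intro n_times_diff_compose[OF n_times_diff_flat_exp] n_times_diff_diff n_times_diff_const)
    have "w * (s + l - x) = w * (s - x) + 2 * pi" for s
      using w(2) by (simp add: algebra_simps)
    then show "function_on_curve k l \<eta>"
      by (simp add: function_on_curve_def Closed \<eta>_def)
    have "cos (w * d) < cos 0"
      using wd by (intro cos_monotone_0_pi) auto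
    then show "0 < \<eta> x" by (simp add: \<eta>_def flat_exp_pos_iff)
    show "0 \<le> \<eta> s" for s by (simp add: \<eta>_def flat_exp_nonneg)
  qed (simp_all add: van Closed)
qed


section \<open>Continuous weak derivatives\<close>

lemma continuous_imp_antiderivative:
  fixes f :: "real \<Rightarrow> 'a::euclidean_space"
  assumes "continuous_on UNIV f"
  shows "\<exists>F. \<forall>x. (F has_vector_derivative f x) (at x)"
  using einterval_antiderivative[of "-\<infinity>" "\<infinity>" f] assms by (simp add: continuous_on_eq_continuous_at)

text \<open>The du Bois-Reymond lemma. If \<open>f x < m < f y\<close>, two opposite bumps of equal
  mass at \<open>x\<close> and \<open>y\<close> have a primitive that is a test function, and
  pairing it with \<open>f\<close> contradicts \<open>null\<close>. Swapping \<open>x\<close> and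
  \<open>y\<close> then gives equality. The end conditions on \<open>\<psi>\<close> hold for this
  primitive and later remove boundary terms.\<close>

lemma test_fun_integral_eq_0_imp_not_less:
  fixes f :: "real \<Rightarrow> real"
  assumes cont: "continuous_on {0..l} f"
    and null: "\<And>\<psi>. test_fun k l \<psi> \<Longrightarrow> continuous_on UNIV (deriv \<psi>) \<Longrightarrow> \<psi> 0 = 0 \<Longrightarrow> \<psi> l = 0
      \<Longrightarrow> integral {0..l} (\<lambda>s. deriv \<psi> s * f s) = 0"
    and xy: "x \<in> {0<..<l}" "y \<in> {0<..<l}"
  shows "\<not> f x < f y"
proof
  assume "f x < f y"
  then obtain m where m: "f x < m" "m < f y"
    using dense by blast
  have contf: "isCont f z" if "z \<in> {0<..<l}" for z
    using that cont continuous_on_interior[of "{0..l}" f z] by simp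
  have near: "\<exists>d>0. \<forall>s. \<bar>s - z\<bar> < d \<longrightarrow> f s \<in> S" if "open S" "f z \<in> S" "z \<in> {0<..<l}" for S z
    using contf[OF that(3)] that(1,2)
    by (auto simp: continuous_at_open dist_real_def open_dist dest: topological_tendstoD
        elim!: allE[of _ S]) (metis dist_real_def)
  obtain d1 d2 where d12: "0 < d1" "\<And>s. \<bar>s - x\<bar> < d1 \<Longrightarrow> f s < m"
    "0 < d2" "\<And>s. \<bar>s - y\<bar> < d2 \<Longrightarrow> m < f s"
    using near[of "{..<m}" x] near[of "{m<..}" y] xy m by auto
  define d where "d = Min {d1, d2, x, y, l - x, l - y}"
  have d: "0 < d" "d \<le> d1" "d \<le> d2" "d \<le> x" "d \<le> y" "x + d \<le> l" "y + d \<le> l"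
    using d12 xy by (auto simp: d_def min_def)
  \<comment> \<open>Halving leaves a margin, so that on an arc the support stays inside a compact
    part of the open interval.\<close>
  define e where "e = d / 2"
  have e: "0 < e" "e < d" using d by (auto simp: e_def)
  obtain \<eta> where \<eta>: "\<And>n. n_times_diff n \<eta>" "\<And>s. 0 \<le> \<eta> s" "function_on_curve k l \<eta>" "0 < \<eta> x"
    "\<And>s. s \<in> {0..l} \<Longrightarrow> e \<le> \<bar>s - x\<bar> \<Longrightarrow> \<eta> s = 0" "\<And>s. k = Arc \<Longrightarrow> e \<le> \<bar>s - x\<bar> \<Longrightarrow> \<eta> s = 0"
    using bump_on_curve[of e x l k] d e by auto
  obtain \<theta> where \<theta>: "\<And>n. n_times_diff n \<theta>" "\<And>s. 0 \<le> \<theta> s" "function_on_curve k l \<theta>" "0 < \<theta> y"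
    "\<And>s. s \<in> {0..l} \<Longrightarrow> e \<le> \<bar>s - y\<bar> \<Longrightarrow> \<theta> s = 0" "\<And>s. k = Arc \<Longrightarrow> e \<le> \<bar>s - y\<bar> \<Longrightarrow> \<theta> s = 0"
    using bump_on_curve[of e y l k] d e by auto
  have cont_if: "continuous_on A h" if "\<And>n. n_times_diff n h" for A and h :: "real \<Rightarrow> real"
    using that[of 1] by (auto intro: DERIV_continuous_on has_field_derivative_at_within)
  have l: "0 < l" using xy by auto
  define a where "a = integral {0..l} \<theta>"
  define b where "b = integral {0..l} \<eta>"
  have pos: "0 < integral {0..l} h"
    if "\<And>n. n_times_diff n h" "\<And>s. 0 \<le> h s" "0 < h z" "z \<in> {0<..<l}" for h z
  proof -
    have "integral {0..l} h \<noteq> 0"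
      using that l by (subst integral_eq_0_iff) (auto intro!: cont_if bexI[of _ z])
    moreover have "0 \<le> integral {0..l} h"
      using that by (intro integral_nonneg integrable_continuous_real cont_if) auto
    ultimately show ?thesis by simp
  qed
  have a: "0 < a" and b: "0 < b"
    using pos \<eta> \<theta> xy by (auto simp: a_def b_def)
  \<comment> \<open>The coefficients give \<open>h\<close> integral zero, so its primitive vanishing at \<open>0\<close> is a test function.\<close>
  define h where "h s = a * \<eta> s - b * \<theta> s" for s
  have h: "n_times_diff n h" for n
    unfolding h_def by (intro n_times_diff_diff n_times_diff_cmult \<eta> \<theta>)
  have conth: "continuous_on A h" for A
    using cont_if h by blast
  have int_h: "(h has_integral 0) {0..l}"
  proof -
    have "(h has_integral a * b - b * a) {0..l}"
      unfolding h_def a_def b_def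
      by (intro has_integral_diff has_integral_mult_right integrable_integral
          integrable_continuous_real cont_if \<eta> \<theta>)
    then show ?thesis by (simp add: mult.commute)
  qed
  obtain H where H: "\<And>s. (H has_real_derivative h s) (at s)"
    using continuous_imp_antiderivative[OF conth[of UNIV]]
    by (auto simp: has_real_derivative_iff_has_vector_derivative)
  define \<psi> where "\<psi> s = H s - H 0" for s
  have d\<psi>: "(\<psi> has_real_derivative h s) (at s)" for s
    unfolding \<psi>_def by (auto intro!: derivative_eq_intros H)
  have deriv\<psi>: "deriv \<psi> = h"
    by (intro ext DERIV_imp_deriv d\<psi>)
  have "(h has_integral \<psi> l - \<psi> 0) {0..l}"
    using l d\<psi> by (intro fundamental_theorem_of_calculus)
      (auto simp flip: has_real_derivative_iff_has_vector_derivative intro: has_field_derivative_at_within)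
  with int_h have ends: "\<psi> 0 = 0" "\<psi> l = 0"
    by (auto simp: \<psi>_def dest: has_integral_unique)
  \<comment> \<open>On an arc this is applied to the rays left and right of both bumps, where
    \<open>\<psi>\<close> inherits the value 0 from the ends.\<close>
  have const_\<psi>: "\<psi> s = \<psi> t" if "convex S" "\<And>u. u \<in> S \<Longrightarrow> h u = 0" "s \<in> S" "t \<in> S" for S s t
  proof (rule has_derivative_zero_unique[where f = \<psi>, OF that(1) _ that(3,4)])
    show "(\<psi> has_derivative (\<lambda>h. 0)) (at u within S)" if "u \<in> S" for u
      using has_field_derivative_at_within[OF d\<psi>] \<open>\<And>u. u \<in> S \<Longrightarrow> h u = 0\<close>[OF that]
      by (metis has_field_derivative_def lambda_zero)
  qed
  have "test_fun k l \<psi>"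
  proof -
    have "n_times_diff n \<psi>" for n
      using d\<psi> h by (cases n) auto
    then have "smooth_fun \<psi>" by (rule smooth_fun_if_n_times_diff)
    moreover have "\<exists>a b. 0 < a \<and> b < l \<and> (\<forall>s. s \<notin> {a..b} \<longrightarrow> \<psi> s = 0)" if "k = Arc"
    proof (intro exI conjI allI impI)
      let ?a = "min x y - e" and ?b = "max x y + e"
      show "0 < ?a" "?b < l" using d e by auto
      show "\<psi> s = 0" if s: "s \<notin> {?a..?b}" for s
      proof (cases "s < ?a")
        case True
        have "\<psi> s = \<psi> 0"
          using True \<open>0 < ?a\<close> that
          by (intro const_\<psi>[of "{..<?a}"]) (auto simp: h_def \<eta>(6)[OF \<open>k = Arc\<close>] \<theta>(6)[OF \<open>k = Arc\<close>])
        then show ?thesis by (simp add: ends)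
      next
        case False
        have "\<psi> s = \<psi> l"
          using False \<open>?b < l\<close> s
          by (intro const_\<psi>[of "{?b<..}"]) (auto simp: h_def \<eta>(6)[OF \<open>k = Arc\<close>] \<theta>(6)[OF \<open>k = Arc\<close>])
        then show ?thesis by (simp add: ends)
      qed
    qed
    moreover have "function_on_curve k l \<psi>"
    proof (cases k)
      case Closed
      \<comment> \<open>Periodicity of \<open>h\<close> makes the increment over a period constant,
        and it vanishes at \<open>s = 0\<close>.\<close>
      have "\<psi> (s + l) - \<psi> s = \<psi> (0 + l) - \<psi> 0" for s
      proof (rule DERIV_isconst_all[where f = "\<lambda>s. \<psi> (s + l) - \<psi> s"], rule allI)
        fix u
        have "h (u + l) = h u"
          using \<eta>(3) \<theta>(3) Closed by (simp add: function_on_curve_def h_def)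
        then show "((\<lambda>s. \<psi> (s + l) - \<psi> s) has_real_derivative 0) (at u)"
          using DERIV_diff[OF d\<psi>[of "u + l", unfolded DERIV_shift] d\<psi>[of u]] by simp
      qed
      then show ?thesis
        by (simp add: function_on_curve_def Closed ends)
    qed (simp add: function_on_curve_def)
    ultimately show ?thesis by (simp add: test_fun_def)
  qed
  then have "integral {0..l} (\<lambda>s. h s * f s) = 0"
    using null[of \<psi>] ends conth by (simp add: deriv\<psi>)
  \<comment> \<open>As \<open>h\<close> has integral zero, \<open>f\<close> may be shifted by
    \<open>m\<close>, which gives the integrand a sign.\<close>
  moreover have "integral {0..l} (\<lambda>s. h s * f s) = integral {0..l} (\<lambda>s. h s * f s) - m * integral {0..l} h"
    using int_h by (simp add: integral_unique)
  also have "\<dots> = - integral {0..l} (\<lambda>s. h s * (m - f s))"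
    by (simp add: right_diff_distrib mult.commute[of _ m] integral_diff integrable_continuous_real
        continuous_intros conth cont)
  ultimately have "integral {0..l} (\<lambda>s. h s * (m - f s)) = 0"
    by simp
  \<comment> \<open>On \<open>{0..l}\<close>, \<open>\<eta>\<close> lives where \<open>f < m\<close>
    and \<open>\<theta>\<close> where \<open>f > m\<close>, so both terms of \<open>h\<close>
    contribute nonnegatively.\<close>
  moreover have "0 \<le> h s * (m - f s)" if s: "s \<in> {0..l}" for s
  proof -
    have "0 \<le> \<eta> s * (m - f s)"
      using \<eta>(2,5)[of s] d12(2)[of s] d e s by (cases "e \<le> \<bar>s - x\<bar>") auto
    moreover have "\<theta> s * (m - f s) \<le> 0"
      using \<theta>(2,5)[of s] d12(4)[of s] d e s by (cases "e \<le> \<bar>s - y\<bar>") (auto intro: mult_nonneg_nonpos)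
    ultimately have "0 \<le> a * (\<eta> s * (m - f s)) - b * (\<theta> s * (m - f s))"
      using a b mult_nonneg_nonneg[of a "\<eta> s * (m - f s)"] mult_nonneg_nonpos[of b "\<theta> s * (m - f s)"]
      by linarith
    then show ?thesis by (simp add: h_def algebra_simps)
  qed
  ultimately have "\<forall>s\<in>{0..l}. h s * (m - f s) = 0"
    using l by (subst (asm) integral_eq_0_iff) (auto intro!: continuous_intros conth cont)
  with xy m have "h x = 0" by auto
  moreover have "\<theta> x = 0"
    using \<theta>(5)[of x] d12(4)[of x] m(1) e d xy by (cases "e \<le> \<bar>x - y\<bar>") auto
  ultimately show False
    using a \<eta>(4) by (simp add: h_def)
qed

text \<open>Subtracting a primitive of \<open>g\<close> leaves a function with vanishing weak
  derivative, which is constant by the du Bois-Reymond lemma applied to its components.\<close>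

lemma has_weak_derivative_imp_derivative_Icc:
  fixes f g :: "real \<Rightarrow> 'a::euclidean_space"
  assumes l: "0 < l" and weak: "has_weak_derivative k l f g"
    and cont: "continuous_on {0..l} f" "continuous_on {0..l} g" and s: "s \<in> {0..l}"
  shows "(f has_vector_derivative g s) (at s within {0..l})"
proof -
  define G where "G s = integral {0..s} g" for s
  have G: "(G has_vector_derivative g s) (at s within {0..l})" if "s \<in> {0..l}" for s
    unfolding G_def using integral_has_vector_derivative[OF cont(2) that] .
  have contG: "continuous_on {0..l} G"
    using G by (rule continuous_on_vector_derivative)
  define D where "D s = f s - G s" for s
  have contD: "continuous_on {0..l} D"
    unfolding D_def by (intro continuous_intros cont contG)
  have null: "integral {0..l} (\<lambda>s. deriv \<psi> s * (D s \<bullet> b)) = 0"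
    if \<psi>: "test_fun k l \<psi>" "continuous_on UNIV (deriv \<psi>)" "\<psi> 0 = 0" "\<psi> l = 0" for \<psi> b
  proof -
    have "((deriv ^^ 0) \<psi>) differentiable (at s)" for s
      using \<psi>(1) unfolding test_fun_def smooth_fun_def by blast
    then have d\<psi>: "(\<psi> has_real_derivative deriv \<psi> s) (at s)" for s
      by (simp add: DERIV_deriv_iff_real_differentiable)
    have cont\<psi>: "continuous_on {0..l} \<psi>"
      using d\<psi> by (auto intro: DERIV_continuous_on has_field_derivative_at_within)
    have contd: "continuous_on {0..l} (deriv \<psi>)"
      using \<psi>(2) continuous_on_subset by blast
    \<comment> \<open>Integration by parts. \<open>G\<close> need not be periodic, so the boundary
      terms are removed by the zeros of \<open>\<psi>\<close> at both ends.\<close>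
    have "((\<lambda>s. \<psi> s *\<^sub>R g s + deriv \<psi> s *\<^sub>R G s) has_integral (\<psi> l *\<^sub>R G l - \<psi> 0 *\<^sub>R G 0)) {0..l}"
      using l by (intro fundamental_theorem_of_calculus)
        (auto intro!: has_vector_derivative_scaleR has_field_derivative_at_within d\<psi> G)
    then have "integral {0..l} (\<lambda>s. \<psi> s *\<^sub>R g s) + integral {0..l} (\<lambda>s. deriv \<psi> s *\<^sub>R G s) = 0"
      using \<psi>(3,4)
      by (subst integral_add[symmetric])
        (auto intro!: integrable_continuous_real continuous_intros cont contG contd cont\<psi> integral_unique)
    moreover have "integral {0..l} (\<lambda>s. deriv \<psi> s *\<^sub>R f s) = - integral {0..l} (\<lambda>s. \<psi> s *\<^sub>R g s)"
      using weak \<psi>(1) by (simp add: has_weak_derivative_def)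
    ultimately have "integral {0..l} (\<lambda>s. deriv \<psi> s *\<^sub>R f s) - integral {0..l} (\<lambda>s. deriv \<psi> s *\<^sub>R G s) = 0"
      by (simp add: add_eq_0_iff)
    then have "integral {0..l} (\<lambda>s. deriv \<psi> s *\<^sub>R f s - deriv \<psi> s *\<^sub>R G s) = 0"
      by (subst integral_diff)
        (auto intro!: integrable_continuous_real continuous_intros cont contG contd)
    then have "integral {0..l} (\<lambda>s. deriv \<psi> s *\<^sub>R D s) = 0"
      by (simp add: D_def scaleR_diff_right)
    moreover have "integral {0..l} (\<lambda>s. (deriv \<psi> s *\<^sub>R D s) \<bullet> b) = integral {0..l} (\<lambda>s. deriv \<psi> s *\<^sub>R D s) \<bullet> b"
      by (intro integral_component_eq integrable_continuous_real continuous_intros contD contd)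
    ultimately show ?thesis
      by simp
  qed
  have "D x = D y" if "x \<in> {0<..<l}" "y \<in> {0<..<l}" for x y
  proof (rule euclidean_eqI)
    fix b :: 'a
    have "\<not> D u \<bullet> b < D v \<bullet> b" if "u \<in> {0<..<l}" "v \<in> {0<..<l}" for u v
      by (rule test_fun_integral_eq_0_imp_not_less[of l "\<lambda>s. D s \<bullet> b" k])
        (use that in \<open>auto intro!: continuous_intros contD null\<close>)
    with that show "D x \<bullet> b = D y \<bullet> b"
      by (meson linorder_neqE)
  qed
  then have mid: "\<And>x. x \<in> {0<..<l} \<Longrightarrow> D x = D (l / 2)"
    using l by (metis field_sum_of_halves greaterThanLessThan_iff half_gt_zero less_add_same_cancel2)
  \<comment> \<open>Continuity carries the constancy from the open interval to its
    endpoints.\<close>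
  have D_eq: "D x = D (l / 2)" if "x \<in> {0..l}" for x
    using continuous_constant_on_closure[of "{0<..<l}" D "D (l / 2)" x] mid contD that
    unfolding closure_greaterThanLessThan[OF l] by blast
  have eq: "f x = G x + D (l / 2)" if "x \<in> {0..l}" for x
    using D_eq[OF that] D_def[of x] by (simp add: algebra_simps)
  have deriv: "((\<lambda>x. G x + D (l / 2)) has_vector_derivative g s) (at s within {0..l})"
    using G[OF s] by (auto intro!: derivative_eq_intros)
  show ?thesis
    by (rule has_vector_derivative_transform[OF s _ deriv]) (rule eq)
qed

lemma has_vector_derivative_compose_shift:
  fixes f :: "real \<Rightarrow> 'a::real_normed_vector"
  assumes "(f has_vector_derivative D) (at (x + l))"
  shows "((\<lambda>u. f (u + l)) has_vector_derivative D) (at x)"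
proof -
  have "((\<lambda>u. u + l) has_vector_derivative 1) (at x)"
    by (auto intro!: derivative_eq_intros)
  then show ?thesis
    using vector_diff_chain_at[of "\<lambda>u. u + l" 1 x f D] assms by (simp add: o_def)
qed

text \<open>On a closed curve the result on \<open>{0..l}\<close> gives only one-sided derivatives
  at the seam. Comparing \<open>f\<close> with a primitive of \<open>g\<close> on the whole line,
  and using periodicity, makes them two-sided.\<close>

lemma has_weak_derivative_imp_derivative:
  fixes f g :: "real \<Rightarrow> 'a::euclidean_space"
  assumes l: "0 < l" and weak: "has_weak_derivative k l f g"
    and cont: "continuous_on (params k l) f" "continuous_on (params k l) g"
    and per: "function_on_curve k l f" "function_on_curve k l g" and s: "s \<in> params k l"
  shows "(f has_vector_derivative g s) (at s within params k l)"
proof (cases k)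
  case Arc
  then show ?thesis
    using has_weak_derivative_imp_derivative_Icc[OF l weak] assms by (simp add: params_def)
next
  case Closed
  then have P: "params k l = UNIV" by (simp add: params_def)
  have f: "(f has_vector_derivative g s) (at s within {0..l})" if "s \<in> {0..l}" for s
    using has_weak_derivative_imp_derivative_Icc[OF l weak _ _ that] cont continuous_on_subset
    unfolding P by blast
  obtain G where G: "\<And>s. (G has_vector_derivative g s) (at s)"
    using continuous_imp_antiderivative[OF cont(2)[unfolded P]] by blast
  define D where "D s = f s - G s" for s
  have D_eq: "D u = D v" if "u \<in> {0..l}" "v \<in> {0..l}" for u v
  proof (rule has_derivative_zero_unique[where f = D, OF _ _ that])
    fix x assume "x \<in> {0..l}"
    then have "(D has_vector_derivative 0) (at x within {0..l})"
      unfolding D_def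
      using has_vector_derivative_diff[OF f has_vector_derivative_at_within[OF G]] by force
    then show "(D has_derivative (\<lambda>h. 0)) (at x within {0..l})"
      by (simp add: has_vector_derivative_def)
  qed simp
  \<comment> \<open>The increment of \<open>G\<close> over a period is constant because
    \<open>g\<close> is periodic. It is in fact zero, since \<open>D\<close> agrees at 0 and
    \<open>l\<close>; this makes \<open>D\<close> periodic.\<close>
  have G_shift: "G (u + l) - G u = G (0 + l) - G 0" for u
  proof (rule has_derivative_zero_unique[where f = "\<lambda>u. G (u + l) - G u" and s = UNIV])
    fix x
    have "((\<lambda>u. G (u + l)) has_vector_derivative g (x + l)) (at x)"
      by (rule has_vector_derivative_compose_shift[OF G])
    then have "((\<lambda>u. G (u + l) - G u) has_vector_derivative g (x + l) - g x) (at x)"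
      by (intro has_vector_derivative_diff G)
    then show "((\<lambda>u. G (u + l) - G u) has_derivative (\<lambda>h. 0)) (at x)"
      using per(2) by (simp add: has_vector_derivative_def function_on_curve_def Closed)
  qed auto
  have f_shift: "f (u + l) = f u" for u
    using per(1) by (simp add: function_on_curve_def Closed)
  have "D (u + l) = D u" for u
  proof -
    have "D (u + l) - D u = D (0 + l) - D 0"
      unfolding D_def f_shift using G_shift[of u] by (simp add: algebra_simps)
    then show ?thesis using D_eq[of l 0] l by simp
  qed
  then interpret D: periodic_fun_simple D l
    by unfold_locales
  have D_const: "D x = D 0" for x
  proof -
    have "D (x - of_int \<lfloor>x / l\<rfloor> * l) = D 0"
      using floor_divide_lower[OF l, of x] floor_divide_upper[OF l, of x] l
      by (intro D_eq) (auto simp: algebra_simps)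
    then show ?thesis
      by (simp only: D.minus_of_int)
  qed
  have "f = (\<lambda>x. G x + D 0)"
  proof
    show "f x = G x + D 0" for x
      using D_const[of x] D_def[of x] by (simp add: algebra_simps)
  qed
  then show ?thesis
    using G[of s] by (auto intro!: derivative_eq_intros simp: P)
qed


section \<open>Kink tension functions\<close>

lemma at_within_params_neq_bot: "0 < l \<Longrightarrow> s \<in> params k l \<Longrightarrow> at s within params k l \<noteq> bot"
  by (cases k) (auto simp: params_def trivial_limit_within)

lemma convex_params: "convex (params k l)"
  by (cases k) (auto simp: params_def)

text \<open>Shifting by \<open>l\<close> in either direction shows that both points admit the same
  derivatives, so the choice in \<open>vector_derivative\<close> agrees even where no derivative
  exists.\<close>

lemma function_on_curve_vector_derivative:
  fixes f :: "real \<Rightarrow> 'a::real_normed_vector"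
  assumes "function_on_curve k l f"
  shows "function_on_curve k l (\<lambda>s. vector_derivative f (at s within params k l))"
proof (cases k)
  case Closed
  then have f: "f (s + l) = f s" "f (s + - l) = f s" for s
    using assms spec[of "\<lambda>s. f (s + l) = f s" "s - l"] by (auto simp: function_on_curve_def)
  have "(f has_vector_derivative D) (at (s + l)) \<longleftrightarrow> (f has_vector_derivative D) (at s)" for s D
    using has_vector_derivative_compose_shift[of f D s l]
      has_vector_derivative_compose_shift[of f D "s + l" "- l"] unfolding f by auto
  then show ?thesis
    by (simp add: function_on_curve_def params_def Closed vector_derivative_def)
qed (simp add: function_on_curve_def)

lemma inner_cross3_squared:
  fixes v t n :: "real ^ 3"
  assumes "norm t = 1" "norm n = 1" "t \<bullet> n = 0"
  shows "(v \<bullet> cross3 t n)\<^sup>2 = (norm v)\<^sup>2 - (v \<bullet> t)\<^sup>2 - (v \<bullet> n)\<^sup>2"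
proof -
  \<comment> \<open>The right side is the Gram determinant of \<open>v\<close>, \<open>t\<close>,
    \<open>n\<close>, expanded along its first row.\<close>
  have "(v \<bullet> cross3 t n)\<^sup>2 = (v \<bullet> v) * ((t \<bullet> t) * (n \<bullet> n) - (t \<bullet> n)\<^sup>2)
      - (v \<bullet> t) * ((v \<bullet> t) * (n \<bullet> n) - (v \<bullet> n) * (t \<bullet> n))
      + (v \<bullet> n) * ((v \<bullet> t) * (t \<bullet> n) - (v \<bullet> n) * (t \<bullet> t))"
    by (simp add: cross3_def inner_vec_def sum_3 vector_def power2_eq_square algebra_simps)
  moreover have "t \<bullet> t = 1" "n \<bullet> n = 1"
    using assms by (simp_all add: dot_square_norm)
  ultimately show ?thesis
    using assms by (simp add: dot_square_norm power2_eq_square)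
qed

text \<open>Fixes one witness \<open>V\<close> for the virtual tangent, so that all identities below
  refer to the same vector.\<close>

locale kink_curve =
  fixes k :: curve_kind and l :: real and \<gamma> :: "real \<Rightarrow> real ^ 3" and \<phi> :: "real \<Rightarrow> real"
    and V :: "real ^ 3"
  assumes curve: "C11_curve k l \<gamma>"
    and tension: "kink_tension_function k l \<gamma> \<phi>"
    and weak: "has_weak_derivative k l (kink_normal k l \<gamma> \<phi>)
      (\<lambda>s. (1 - 2 * \<phi> s) *\<^sub>R tangent k l \<gamma> s - V)"
begin

abbreviation "P \<equiv> params k l"
abbreviation "T \<equiv> tangent k l \<gamma>"
abbreviation "N \<equiv> normal k l \<gamma>"
abbreviation "W \<equiv> kink_normal k l \<gamma> \<phi>"
abbreviation "\<tau> \<equiv> torsion k l \<gamma>"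

section \<open>Regularity of the tangent and the kink normal\<close>

lemma length_pos: "0 < l"
  using curve by (simp add: C11_curve_def)

lemmas not_bot = at_within_params_neq_bot[OF length_pos]

lemma norm_T: "s \<in> P \<Longrightarrow> norm (T s) = 1"
  using curve by (simp add: C11_curve_def)

lemma continuous_T: "continuous_on P T"
  using curve by (auto simp: C11_curve_def intro: lipschitz_on_continuous_on)

lemma nonneg: "s \<in> P \<Longrightarrow> 0 \<le> \<phi> s"
  using tension by (simp add: kink_tension_function_def)

lemma continuous_tension: "continuous_on P \<phi>"
  using tension by (simp add: kink_tension_function_def W1BV_def)

lemma pos_near:
  assumes "s \<in> P" "0 < \<phi> s"
  obtains d where "0 < d" "\<And>x. x \<in> P \<Longrightarrow> dist x s < d \<Longrightarrow> 0 < \<phi> x"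
proof -
  obtain d where "0 < d" and d: "\<And>x. x \<in> P \<Longrightarrow> dist x s < d \<Longrightarrow> dist (\<phi> x) (\<phi> s) < \<phi> s"
    using continuous_tension assms unfolding continuous_on_iff by metis
  moreover have "0 < \<phi> x" if "x \<in> P" "dist x s < d" for x
    using d[OF that] by (auto simp: dist_real_def)
  ultimately show ?thesis using that by blast
qed

lemma normal_eq_curvature:
  assumes "s \<in> P" "0 < \<phi> s"
  shows "N s = curvature_vector k l \<gamma> s" "norm (N s) = 1"
  using assms tension by (auto simp: normal_def kink_tension_function_def Let_def)

lemma T_deriv:
  assumes "s \<in> P" "0 < \<phi> s"
  shows "(T has_vector_derivative N s) (at s within P)"
proof -
  have "T differentiable (at s within P)"
    using assms tension by (auto simp: kink_tension_function_def Let_def)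
  then show ?thesis
    by (simp add: normal_eq_curvature[OF assms] curvature_vector_def vector_derivative_works)
qed

text \<open>Differentiate the constant \<open>T \<bullet> T = 1\<close>.\<close>

lemma T_inner_N:
  assumes "s \<in> P" "0 < \<phi> s"
  shows "T s \<bullet> N s = 0"
proof -
  have "((\<lambda>x. T x \<bullet> T x) has_vector_derivative T s \<bullet> N s + N s \<bullet> T s) (at s within P)"
    by (intro bounded_bilinear.has_vector_derivative[OF bounded_bilinear_inner] T_deriv assms)
  moreover have "((\<lambda>x. T x \<bullet> T x) has_vector_derivative 0) (at s within P)"
    by (rule has_vector_derivative_transform[OF assms(1) _ has_vector_derivative_const[of 1]])
      (simp add: dot_square_norm norm_T)
  ultimately show ?thesis
    using vector_derivative_unique_within[OF not_bot[OF assms(1)]] by (force simp: inner_commute)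
qed

lemma norm_W: "s \<in> P \<Longrightarrow> norm (W s) = \<phi> s"
  using nonneg[of s] normal_eq_curvature(2)[of s] by (auto simp: kink_normal_def)

lemma T_inner_W: "s \<in> P \<Longrightarrow> T s \<bullet> W s = 0"
  by (simp add: kink_normal_def T_inner_N)

text \<open>Where \<phi> is positive the set \<open>?U\<close> is a relative neighbourhood, so
  continuity within it suffices. At a zero of \<phi>, the norm of \<open>W\<close> equals \<phi> and
  tends to 0.\<close>

lemma continuous_W: "continuous_on P W"
  unfolding continuous_on_eq_continuous_within
proof
  fix s assume s: "s \<in> P"
  show "continuous (at s within P) W"
  proof (cases "0 < \<phi> s")
    case True
    let ?U = "{s \<in> P. 0 < \<phi> s}"
    obtain d where d: "0 < d" "\<And>x. x \<in> P \<Longrightarrow> dist x s < d \<Longrightarrow> 0 < \<phi> x"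
      using pos_near[OF s True] by blast
    have "continuous_on ?U (\<lambda>s. \<phi> s *\<^sub>R curvature_vector k l \<gamma> s)"
      using tension
      by (intro continuous_intros continuous_on_subset[OF continuous_tension])
        (auto simp: kink_tension_function_def Let_def)
    then have "continuous_on ?U W"
      by (rule continuous_on_eq) (auto simp: kink_normal_def normal_eq_curvature)
    then have "continuous (at s within ?U) W"
      using s True by (simp add: continuous_on_eq_continuous_within)
    moreover have "at s within ?U = at s within P"
      by (rule at_within_nhd[of s "ball s d"]) (use d in \<open>auto simp: dist_commute\<close>)
    ultimately show ?thesis by simp
  next
    case False
    with s nonneg have 0: "\<phi> s = 0" by force
    have "(\<phi> \<longlongrightarrow> 0) (at s within P)"
      using continuous_tension s 0 by (force simp: continuous_on_def)
    then have "((\<lambda>x. norm (W x)) \<longlongrightarrow> 0) (at s within P)"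
      by (rule Lim_transform_eventually) (auto simp: eventually_at_filter norm_W)
    moreover have "W s = 0"
      by (simp add: kink_normal_def 0)
    ultimately show ?thesis
      by (simp add: continuous_within tendsto_norm_zero_iff)
  qed
qed

text \<open>The weak derivative is continuous, hence classical. This holds at zeros of \<phi>
  too.\<close>

lemma W_deriv:
  assumes "s \<in> P"
  shows "(W has_vector_derivative (1 - 2 * \<phi> s) *\<^sub>R T s - V) (at s within P)"
proof (rule has_weak_derivative_imp_derivative[OF length_pos weak continuous_W _ _ _ assms])
  show "continuous_on P (\<lambda>s. (1 - 2 * \<phi> s) *\<^sub>R T s - V)"
    by (intro continuous_intros continuous_T continuous_tension)
  have "function_on_curve k l \<phi>" "function_on_curve k l T" "function_on_curve k l N"
  proof -
    show "function_on_curve k l \<phi>"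
      using tension by (simp add: kink_tension_function_def W1BV_def)
    show T: "function_on_curve k l T"
      using function_on_curve_vector_derivative[of k l \<gamma>] curve
      by (simp add: C11_curve_def tangent_def function_on_curve_def split: curve_kind.splits)
    show "function_on_curve k l N"
      using function_on_curve_vector_derivative[OF T]
      by (simp add: normal_def curvature_vector_def function_on_curve_def split: curve_kind.splits)
  qed
  then show "function_on_curve k l W" "function_on_curve k l (\<lambda>s. (1 - 2 * \<phi> s) *\<^sub>R T s - V)"
    by (auto simp: function_on_curve_def kink_normal_def split: curve_kind.splits)
qed

text \<open>\<phi> is the norm of \<open>W\<close>, whose gradient at \<open>W s\<close> is
  \<open>N s\<close>; the tangential part of \<open>W'\<close> drops out by orthogonality.\<close>

lemma tension_deriv:
  assumes s: "s \<in> P" "0 < \<phi> s"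
  shows "(\<phi> has_real_derivative - (V \<bullet> N s)) (at s within P)"
proof -
  have W: "W s = \<phi> s *\<^sub>R N s" "W s \<noteq> 0"
    using s norm_W[OF s(1)] by (auto simp: kink_normal_def)
  then have "sgn (W s) = N s"
    using s norm_W[OF s(1)] by (simp add: sgn_div_norm)
  then have "((\<lambda>x. norm (W x)) has_derivative
      (\<lambda>h. (h *\<^sub>R ((1 - 2 * \<phi> s) *\<^sub>R T s - V)) \<bullet> N s)) (at s within P)"
    using has_derivative_compose[OF W_deriv[OF s(1), unfolded has_vector_derivative_def]
        has_derivative_norm[OF W(2)]] by simp
  then have "((\<lambda>x. norm (W x)) has_derivative (*) (- (V \<bullet> N s))) (at s within P)"
    by (rule has_derivative_eq_rhs) (simp add: fun_eq_iff inner_diff_left T_inner_N[OF s])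
  then show ?thesis
    unfolding has_field_derivative_def
    by (rule has_derivative_transform[OF s(1), rotated]) (simp add: norm_W)
qed

text \<open>Differentiate \<open>T \<bullet> W = 0\<close> and use
  \<open>N \<bullet> W = \<phi>\<close>.\<close>

lemma T_inner_V:
  assumes s: "s \<in> P" "0 < \<phi> s"
  shows "V \<bullet> T s = 1 - \<phi> s"
proof -
  have "((\<lambda>x. T x \<bullet> W x) has_vector_derivative
      T s \<bullet> ((1 - 2 * \<phi> s) *\<^sub>R T s - V) + N s \<bullet> W s) (at s within P)"
    by (intro bounded_bilinear.has_vector_derivative[OF bounded_bilinear_inner] T_deriv W_deriv s)
  moreover have "((\<lambda>x. T x \<bullet> W x) has_vector_derivative 0) (at s within P)"
    by (rule has_vector_derivative_transform[OF s(1) _ has_vector_derivative_const[of 0]])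
      (simp add: T_inner_W)
  ultimately have "T s \<bullet> ((1 - 2 * \<phi> s) *\<^sub>R T s - V) + N s \<bullet> W s = 0"
    using vector_derivative_unique_within[OF not_bot[OF s(1)]] by blast
  then show ?thesis
    using s by (simp add: kink_normal_def dot_square_norm norm_T normal_eq_curvature(2)[OF s]
        inner_diff_right inner_commute)
qed

section \<open>Torsion, the conserved quantity and the second derivative\<close>

lemma N_deriv:
  assumes s: "s \<in> P" "0 < \<phi> s"
  shows "(N has_vector_derivative
    inverse (\<phi> s) *\<^sub>R ((1 - 2 * \<phi> s) *\<^sub>R T s - V + (V \<bullet> N s) *\<^sub>R N s)) (at s within P)"
proof -
  obtain d where d: "0 < d" "\<And>x. x \<in> P \<Longrightarrow> dist x s < d \<Longrightarrow> 0 < \<phi> x"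
    using pos_near[OF s] by blast
  have "((\<lambda>x. inverse (\<phi> x)) has_real_derivative (V \<bullet> N s) / (\<phi> s)\<^sup>2) (at s within P)"
    using s by (auto intro!: derivative_eq_intros tension_deriv simp: power2_eq_square field_simps)
  from has_vector_derivative_scaleR[OF this W_deriv[OF s(1)]]
  have "((\<lambda>x. inverse (\<phi> x) *\<^sub>R W x) has_vector_derivative
      inverse (\<phi> s) *\<^sub>R ((1 - 2 * \<phi> s) *\<^sub>R T s - V + (V \<bullet> N s) *\<^sub>R N s)) (at s within P)"
    by (rule has_vector_derivative_eq_rhs)
      (use s in \<open>simp add: kink_normal_def scaleR_add_right power2_eq_square divide_inverse\<close>)
  then show ?thesis
    by (rule has_vector_derivative_transform_within[OF _ d(1) s(1)])
      (use d(2) in \<open>force simp: kink_normal_def\<close>)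
qed

text \<open>The binormal is orthogonal to \<open>T\<close> and \<open>N\<close>, so only the
  \<open>V\<close> term of \<open>N'\<close> survives.\<close>

lemma torsion_eq:
  assumes s: "s \<in> P" "0 < \<phi> s"
  shows "\<phi> s * \<tau> s = - (V \<bullet> binormal k l \<gamma> s)"
  unfolding torsion_def vector_derivative_within[OF not_bot[OF s(1)] N_deriv[OF s]] binormal_def
  using s by (simp add: inner_diff_left inner_add_left dot_cross_self)

text \<open>The right side is continuous on all of \<open>P\<close>, including the zeros of \<phi>,
  where the torsion carries no information.\<close>

lemma tension_squared_torsion:
  assumes s: "s \<in> P" "0 < \<phi> s"
  shows "(\<phi> s)\<^sup>2 * \<tau> s = - (V \<bullet> cross3 (T s) (W s))"
  using torsion_eq[OF s] s
  by (simp add: kink_normal_def binormal_def cross_mult_right power2_eq_square mult.assoc)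

text \<open>The terms with \<open>T \<times> T\<close> and \<open>N \<times> N\<close> cancel; what
  remains is \<open>T \<times> V\<close>, which is orthogonal to \<open>V\<close>.\<close>

lemma inner_cross3_deriv:
  assumes s: "s \<in> P" "0 < \<phi> s"
  shows "((\<lambda>x. - (V \<bullet> cross3 (T x) (W x))) has_vector_derivative 0) (at s within P)"
proof -
  have "((\<lambda>x. cross3 (T x) (W x)) has_vector_derivative
      cross3 (T s) ((1 - 2 * \<phi> s) *\<^sub>R T s - V) + cross3 (N s) (W s)) (at s within P)"
    using bilinear_cross
    by (intro bounded_bilinear.has_vector_derivative T_deriv W_deriv s)
      (simp flip: bilinear_conv_bounded_bilinear)
  then have "((\<lambda>x. cross3 (T x) (W x)) has_vector_derivative - cross3 (T s) V) (at s within P)"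
    by (rule has_vector_derivative_eq_rhs)
      (use s in \<open>simp add: kink_normal_def cross_mult_right Cross3.right_diff_distrib\<close>)
  then have "((\<lambda>x. - (V \<bullet> cross3 (T x) (W x))) has_vector_derivative
      - (V \<bullet> - cross3 (T s) V)) (at s within P)"
    by (intro has_vector_derivative_minus
        bounded_linear.has_vector_derivative[OF bounded_linear_inner_right])
  then show ?thesis
    by (simp add: dot_cross_self)
qed

lemma second_deriv:
  assumes s: "s \<in> P" "0 < \<phi> s"
  shows "((\<lambda>x. - (V \<bullet> N x)) has_real_derivative 1 - \<phi> s + \<phi> s * (\<tau> s)\<^sup>2) (at s within P)"
proof -
  have "((\<lambda>x. - (V \<bullet> N x)) has_real_derivative
      - (V \<bullet> (inverse (\<phi> s) *\<^sub>R ((1 - 2 * \<phi> s) *\<^sub>R T s - V + (V \<bullet> N s) *\<^sub>R N s)))) (at s within P)"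
    unfolding has_real_derivative_iff_has_vector_derivative
    by (intro has_vector_derivative_minus N_deriv s
        bounded_linear.has_vector_derivative[OF bounded_linear_inner_right])
  \<comment> \<open>Pythagoras for \<open>V\<close> in the frame of tangent, normal and binormal; it
    eliminates the norm of \<open>V\<close> from the second derivative.\<close>
  moreover have "(\<phi> s * \<tau> s)\<^sup>2 = (norm V)\<^sup>2 - (1 - \<phi> s)\<^sup>2 - (V \<bullet> N s)\<^sup>2"
    unfolding torsion_eq[OF s] binormal_def T_inner_V[OF s, symmetric]
    using inner_cross3_squared[OF norm_T[OF s(1)] normal_eq_curvature(2)[OF s] T_inner_N[OF s]] by simp
  then have V: "(norm V)\<^sup>2 = (\<phi> s * \<tau> s)\<^sup>2 + (1 - \<phi> s)\<^sup>2 + (V \<bullet> N s)\<^sup>2"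
    by simp
  have "- (V \<bullet> (inverse (\<phi> s) *\<^sub>R ((1 - 2 * \<phi> s) *\<^sub>R T s - V + (V \<bullet> N s) *\<^sub>R N s)))
      = ((norm V)\<^sup>2 - (1 - 2 * \<phi> s) * (1 - \<phi> s) - (V \<bullet> N s)\<^sup>2) / \<phi> s"
    using s by (simp add: inner_diff_right inner_add_right T_inner_V[OF s] dot_square_norm
        power2_eq_square field_simps)
  also have "\<dots> = 1 - \<phi> s + \<phi> s * (\<tau> s)\<^sup>2"
    unfolding V using s by (simp add: power2_eq_square field_simps)
  ultimately show ?thesis by simp
qed

text \<open>The level set of the conserved quantity through \<open>p\<close> is closed by
  continuity. As the level is nonzero, \<open>W\<close> cannot vanish on the set, so \<phi> is
  positive there and the quantity is locally constant. Connectedness of \<open>P\<close>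
  finishes.\<close>

lemma torsion_point_propagates:
  assumes p: "p \<in> P" "0 < \<phi> p" "\<tau> p \<noteq> 0" and s: "s \<in> P"
  shows "0 < \<phi> s \<and> (\<phi> s)\<^sup>2 * \<tau> s = (\<phi> p)\<^sup>2 * \<tau> p"
proof -
  let ?h = "\<lambda>x. - (V \<bullet> cross3 (T x) (W x))"
  let ?S = "{x \<in> P. ?h x = ?h p}"
  have hp: "?h p \<noteq> 0"
    using tension_squared_torsion[OF p(1,2)] p by auto
  have pos: "0 < \<phi> x" if "x \<in> ?S" for x
  proof -
    have "x \<in> P" "W x \<noteq> 0" using that hp by auto
    then show ?thesis by (metis norm_W zero_less_norm_iff)
  qed
  have "closedin (top_of_set P) ?S"
    by (intro continuous_closedin_preimage_constant continuous_intros continuous_on_cross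
        continuous_T continuous_W)
  moreover have "openin (top_of_set P) ?S"
    unfolding openin_euclidean_subtopology_iff
  proof safe
    fix x assume x: "x \<in> P" "?h x = ?h p"
    then obtain d where d: "0 < d" "\<And>y. y \<in> P \<Longrightarrow> dist y x < d \<Longrightarrow> 0 < \<phi> y"
      using pos_near pos by blast
    have const: "?h y = ?h x" if "y \<in> P" "dist y x < d" for y
    proof (rule has_derivative_zero_unique[where f = ?h])
      show "convex (P \<inter> ball x d)" by (intro convex_Int convex_params convex_ball)
      show "(?h has_derivative (\<lambda>h. 0)) (at z within P \<inter> ball x d)" if "z \<in> P \<inter> ball x d" for z
      proof -
        have "(?h has_vector_derivative 0) (at z within P)"
          using that d by (intro inner_cross3_deriv) (auto simp: dist_commute)
        then show ?thesis
          unfolding has_vector_derivative_def by (auto intro: has_derivative_subset)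
      qed
    qed (use x that d in \<open>auto simp: dist_commute\<close>)
    have "y \<in> ?S" if "y \<in> P" "dist y x < d" for y
      using const[OF that] that(1) x(2) by simp
    then show "\<exists>e>0. \<forall>y\<in>P. dist y x < e \<longrightarrow> y \<in> ?S"
      using d(1) by blast
  qed
  moreover have "connected P"
    using convex_params by (rule convex_connected)
  ultimately have "?S = {} \<or> ?S = P"
    unfolding connected_clopen by blast
  with p(1) s have "s \<in> ?S" by blast
  then show ?thesis
    using tension_squared_torsion[of s] tension_squared_torsion[OF p(1,2)] pos s by simp
qed

text \<open>A vanishing tension would give \<open>W = 0\<close> and hence \<open>T = V\<close>, a
  straight line. Uniqueness uses this to exclude the zero function.\<close>

lemma tension_pos_somewhere:
  assumes q: "q \<in> P" "T differentiable (at q within P)" "curvature_vector k l \<gamma> q \<noteq> 0"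
  shows "\<exists>s\<in>P. 0 < \<phi> s"
proof (rule ccontr)
  assume "\<not> (\<exists>s\<in>P. 0 < \<phi> s)"
  then have 0: "\<phi> s = 0" if "s \<in> P" for s
    using that nonneg by force
  have "T s = V" if s: "s \<in> P" for s
  proof -
    have "(W has_vector_derivative 0) (at s within P)"
      by (rule has_vector_derivative_transform[OF s _ has_vector_derivative_const[of 0]])
        (simp add: kink_normal_def 0)
    from vector_derivative_unique_within[OF not_bot[OF s] W_deriv[OF s] this] show ?thesis
      using 0[OF s] by simp
  qed
  then have "(T has_vector_derivative 0) (at q within P)"
    by (intro has_vector_derivative_transform[OF q(1) _ has_vector_derivative_const[of V]]) simp
  from vector_derivative_within[OF not_bot[OF q(1)] this] q(3) show False
    by (simp add: curvature_vector_def)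
qed

end

section \<open>Constancy, the differential equation and uniqueness\<close>

lemma kink_curve_if_tension:
  assumes "C11_curve k l \<gamma>" "kink_tension_function k l \<gamma> \<phi>"
  obtains V where "kink_curve k l \<gamma> \<phi> V"
  using assms unfolding kink_tension_function_def kink_curve_def by blast

theorem proposition5p2:
  fixes k :: curve_kind and l :: real and \<gamma> :: "real \<Rightarrow> real ^ 3"
    and \<phi> :: "real \<Rightarrow> real" and p :: real
  assumes curve: "C11_curve k l \<gamma>"
    and kink: "kink_tension_function k l \<gamma> \<phi>"
    and p: "p \<in> params k l" "(\<phi> p)\<^sup>2 * torsion k l \<gamma> p \<noteq> 0"
  shows "(\<exists>c. (\<forall>s\<in>params k l. 0 < \<phi> s \<and> (\<phi> s)\<^sup>2 * torsion k l \<gamma> s = c) \<and>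
            (\<exists>\<phi>'. \<forall>s\<in>params k l.
               (\<phi> has_real_derivative \<phi>' s) (at s within params k l) \<and>
               (\<phi>' has_real_derivative (1 - \<phi> s + c\<^sup>2 / (\<phi> s) ^ 3)) (at s within params k l))) \<and>
         (\<forall>\<psi>. kink_tension_function k l \<gamma> \<psi> \<longrightarrow> (\<forall>s\<in>params k l. \<psi> s = \<phi> s))"
proof (intro conjI allI impI ballI)
  obtain V where "kink_curve k l \<gamma> \<phi> V"
    using kink_curve_if_tension[OF curve kink] .
  then interpret kink_curve k l \<gamma> \<phi> V .
  define c where "c = (\<phi> p)\<^sup>2 * \<tau> p"
  have c: "c \<noteq> 0" using p by (simp add: c_def)
  have "0 < \<phi> p" "\<tau> p \<noteq> 0"
    using p nonneg[of p] by auto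
  then have pos: "0 < \<phi> s" and c_eq: "(\<phi> s)\<^sup>2 * \<tau> s = c" if "s \<in> P" for s
    using torsion_point_propagates[OF p(1) _ _ that] by (auto simp: c_def)
  have "\<phi> s * (\<tau> s)\<^sup>2 = c\<^sup>2 / (\<phi> s) ^ 3" if "s \<in> P" for s
    unfolding c_eq[OF that, symmetric] using pos[OF that]
    by (simp add: power_mult_distrib power2_eq_square power3_eq_cube)
  \<comment> \<open>The witness for the first derivative is
    \<open>- (V \<bullet> N s)\<close>.\<close>
  then show "\<exists>c. (\<forall>s\<in>P. 0 < \<phi> s \<and> (\<phi> s)\<^sup>2 * \<tau> s = c) \<and>
      (\<exists>\<phi>'. \<forall>s\<in>P. (\<phi> has_real_derivative \<phi>' s) (at s within P) \<and>
         (\<phi>' has_real_derivative (1 - \<phi> s + c\<^sup>2 / (\<phi> s) ^ 3)) (at s within P))"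
    using pos c_eq tension_deriv second_deriv by (metis (no_types, lifting))
  fix \<psi> s
  assume kink': "kink_tension_function k l \<gamma> \<psi>" and s: "s \<in> P"
  obtain V' where "kink_curve k l \<gamma> \<psi> V'"
    using kink_curve_if_tension[OF curve kink'] .
  \<comment> \<open>The second tension function has its own virtual tangent \<open>V'\<close>, but
    shares \<open>T\<close>, \<open>N\<close> and \<tau>, which depend on the curve alone.\<close>
  then interpret \<psi>: kink_curve k l \<gamma> \<psi> V' .
  have \<tau>: "\<tau> x \<noteq> 0" if "x \<in> P" for x
    using c c_eq[OF that] by auto
  have "T differentiable (at p within P)" "curvature_vector k l \<gamma> p \<noteq> 0"
    using T_deriv[OF p(1) pos[OF p(1)]] normal_eq_curvature[OF p(1) pos[OF p(1)]]
    by (auto intro: differentiableI_vector)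
  then obtain q where q: "q \<in> P" "0 < \<psi> q"
    using \<psi>.tension_pos_somewhere[OF p(1)] by blast
  \<comment> \<open>The torsion is nonzero everywhere, so a single point where \<psi> is positive
    suffices for propagation.\<close>
  have \<psi>: "0 < \<psi> x" "(\<psi> x)\<^sup>2 * \<tau> x = (\<psi> s)\<^sup>2 * \<tau> s" if "x \<in> P" for x
    using \<psi>.torsion_point_propagates[OF q \<tau>[OF q(1)]] that s by auto
  \<comment> \<open>With \<open>s\<close> fixed, the constant factor is
    \<open>\<psi> s / \<phi> s\<close>, written here without division.\<close>
  have proportional: "\<psi> x * \<phi> s = \<phi> x * \<psi> s" if x: "x \<in> P" for x
  proof -
    have "((\<psi> x)\<^sup>2 * \<tau> x) * ((\<phi> s)\<^sup>2 * \<tau> s) = ((\<psi> s)\<^sup>2 * \<tau> s) * ((\<phi> x)\<^sup>2 * \<tau> x)"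
      using \<psi>(2)[OF x] c_eq[OF x] c_eq[OF s] by simp
    then have "(\<psi> x * \<phi> s)\<^sup>2 = (\<phi> x * \<psi> s)\<^sup>2"
      using \<tau>[OF x] \<tau>[OF s] by (simp add: power_mult_distrib)
    then show ?thesis
      using pos[OF x] pos[OF s] \<psi>(1)[OF x] \<psi>(1)[OF s] by (simp add: power2_eq_iff_nonneg)
  qed
  \<comment> \<open>Proportionality passes to derivatives; it is used once for the first and once
    for the second derivatives.\<close>
  have derivs: "f' * \<phi> s = g' * \<psi> s"
    if "(f has_real_derivative f') (at x within P)" "(g has_real_derivative g') (at x within P)"
      "\<And>y. y \<in> P \<Longrightarrow> f y * \<phi> s = g y * \<psi> s" "x \<in> P" for f g f' g' x
  proof (rule has_field_derivative_unique[OF _ _ not_bot[OF that(4)]])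
    show "((\<lambda>y. g y * \<psi> s) has_real_derivative g' * \<psi> s) (at x within P)"
      by (intro DERIV_cmult_right that)
    have "((\<lambda>y. f y * \<phi> s) has_real_derivative f' * \<phi> s) (at x within P)"
      by (intro DERIV_cmult_right that)
    then show "((\<lambda>y. g y * \<psi> s) has_real_derivative f' * \<phi> s) (at x within P)"
      by (rule has_field_derivative_transform_within[OF _ zero_less_one that(4)]) (simp add: that(3))
  qed
  have "- (V' \<bullet> N x) * \<phi> s = - (V \<bullet> N x) * \<psi> s" if x: "x \<in> P" for x
    by (rule derivs[OF \<psi>.tension_deriv[OF x \<psi>(1)[OF x]] tension_deriv[OF x pos[OF x]] _ x])
      (rule proportional)
  then have "(1 - \<psi> s + \<psi> s * (\<tau> s)\<^sup>2) * \<phi> s = (1 - \<phi> s + \<phi> s * (\<tau> s)\<^sup>2) * \<psi> s"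
    by (rule derivs[OF \<psi>.second_deriv[OF s \<psi>(1)[OF s]] second_deriv[OF s pos[OF s]] _ s])
  \<comment> \<open>All terms containing both tensions cancel; the inhomogeneous 1 leaves
    \<open>\<phi> s = \<psi> s\<close>.\<close>
  then show "\<psi> s = \<phi> s"
    by (simp add: algebra_simps)
qed

end
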